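(* Let $J$ and $K$ be ideals on $\omega$. (a) If $K\leq_{\mathrm{KB}}J$ then $\mathbf{S}_J\preceq_{\mathrm{T}}\mathbf{S}_K$; in particular $\mathfrak{b}_K(\overline{\Omega})\le\mathfrak{b}_J(\overline{\Omega})$ and $\mathfrak{d}_J(\overline{\Omega})\le\mathfrak{d}_K(\overline{\Omega})$. (b) If $K\leq_{\overline{\mathrm{KB}}}J$ then $\mathbf{S}_J\preceq_{\mathrm{T}}\mathbf{S}_K$; in particular $\mathfrak{b}_K(\overline{\Omega})\le\mathfrak{b}_J(\overline{\Omega})$ and $\mathfrak{d}_J(\overline{\Omega})\le\mathfrak{d}_K(\overline{\Omega})$. (c) If $K\leq_{\mathrm{RB}}J$ then $\mathbf{S}_K\preceq_{\mathrm{T}}\mathbf{S}_J$ and $\mathbf{S}_J\preceq_{\mathrm{T}}\mathbf{S}_K$; in particular $\mathfrak{b}_K(\overline{\Omega})=\mathfrak{b}_J(\overline{\Omega})$ and $\mathfrak{d}_K(\overline{\Omega})=\mathfrak{d}_J(\overline{\Omega})$.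
   Context: An ideal on $\omega$ is a family $J\subseteq\mathcal{P}(\omega)$ closed under subsets and finite unions, containing all finite sets, with $\omega\notin J$. ${}^\omega2$ has Lebesgue measure $\mu$; $\Omega$ is the set of its clopen subsets; for $\bar c\in{}^\omega\Omega$, $N(\bar c)=\{x:x\in c_n\text{ for infinitely many }n\}$ and $\overline{\Omega}=\{\bar c\in{}^\omega\Omega:\mu(N(\bar c))=0\}$. For $\bar c,\bar d\in\overline{\Omega}$, $\bar c\subseteq^J\bar d$ iff $\{n:c_n\not\subseteq d_n\}\in J$; $\mathbf{S}_J=\langle\overline{\Omega},\overline{\Omega},\subseteq^J\rangle$; $\mathfrak{b}_J(\overline{\Omega})$ is the least size of a subset of $\overline{\Omega}$ with no $\subseteq^J$-upper bound in $\overline{\Omega}$, and $\mathfrak{d}_J(\overline{\Omega})$ is the least size of $D\subseteq\overline{\Omega}$ such that every $\bar c\in\overline{\Omega}$ satisfies $\bar c\subseteq^J\bar d$ for some $\bar d\in D$. For relational systems $\langle X,Y,R\rangle\preceq_{\mathrm{T}}\langle X',Y',R'\rangle$ iff there are $\varphi_-:X\to X'$, $\varphi_+:Y'\to Y$ with $\varphi_-(x)R'y'\Rightarrow xR\varphi_+(y')$. For $\varphi:\omega\to\omega$, $\varphi^{\to}(J)=\{A:\varphi^{-1}(A)\in J\}$. $K\leq_{\mathrm{KB}}J$ iff some finite-to-one $\varphi$ has $K\subseteq\varphi^{\to}(J)$; $K\leq_{\mathrm{RB}}J$ iff some finite-to-one $\varphi$ has $K=\varphi^{\to}(J)$; $K\leq_{\overline{\mathrm{KB}}}J$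 iff some finite-to-one $\varphi$ has $\varphi^{\to}(K)\subseteq J$. *)

theory Defs
  imports "HOL-Probability.Probability"
begin

unbundle cardinal_syntax

definition ideal_on_nat :: "nat set set \<Rightarrow> bool" where
  "ideal_on_nat J \<longleftrightarrow>
     (\<forall>A\<in>J. \<forall>B. B \<subseteq> A \<longrightarrow> B \<in> J) \<and>
     (\<forall>A\<in>J. \<forall>B\<in>J. A \<union> B \<in> J) \<and>
     (\<forall>A. finite A \<longrightarrow> A \<in> J) \<and>
     UNIV \<notin> J"

(* The Cantor space is the type nat => bool. Its type class topology is the product of the
   order topology on bool, which is discrete. *)

definition cantor_measure :: "(nat \<Rightarrow> bool) measure" where
  "cantor_measure = (\<Pi>\<^sub>M i\<in>(UNIV :: nat set). uniform_count_measure (UNIV :: bool set))"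

definition Omega :: "(nat \<Rightarrow> bool) set set" where
  "Omega = {c. open c \<and> closed c}"

definition N_set :: "(nat \<Rightarrow> (nat \<Rightarrow> bool) set) \<Rightarrow> (nat \<Rightarrow> bool) set" where
  "N_set c = {x. infinite {n. x \<in> c n}}"

(* The set N_set c is a G-delta if all c n are clopen, so it makes no difference that
   cantor_measure is not completed. *)

definition Omega_bar :: "(nat \<Rightarrow> (nat \<Rightarrow> bool) set) set" where
  "Omega_bar = {c. (\<forall>n. c n \<in> Omega) \<and> N_set c \<in> null_sets cantor_measure}"

definition subset_mod ::
  "nat set set \<Rightarrow> (nat \<Rightarrow> (nat \<Rightarrow> bool) set) \<Rightarrow> (nat \<Rightarrow> (nat \<Rightarrow> bool) set) \<Rightarrow> bool" where
  "subset_mod J c d \<longleftrightarrow> {n. \<not> c n \<subseteq> d n} \<in> J"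

type_synonym ('a, 'b) rel_system = "'a set \<times> 'b set \<times> ('a \<Rightarrow> 'b \<Rightarrow> bool)"

definition tukey_le :: "('a, 'b) rel_system \<Rightarrow> ('c, 'd) rel_system \<Rightarrow> bool"
    (infix \<open>\<preceq>\<^sub>T\<close> 50) where
  "S \<preceq>\<^sub>T S' \<longleftrightarrow>
     (case (S, S') of ((X, Y, R), (X', Y', R')) \<Rightarrow>
        \<exists>f\<in>X \<rightarrow> X'. \<exists>g\<in>Y' \<rightarrow> Y. \<forall>x\<in>X. \<forall>y'\<in>Y'. R' (f x) y' \<longrightarrow> R x (g y'))"

definition S_sys ::
  "nat set set \<Rightarrow> (nat \<Rightarrow> (nat \<Rightarrow> bool) set, nat \<Rightarrow> (nat \<Rightarrow> bool) set) rel_system" where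
  "S_sys J = (Omega_bar, Omega_bar, subset_mod J)"

(* The least cardinality of a set satisfying P, as a cardinal order in the sense of HOL's
   cardinal library, determined up to =o. It is meaningful only if some set satisfies P. *)

definition least_size :: "('a set \<Rightarrow> bool) \<Rightarrow> 'a rel" where
  "least_size P = |SOME A. P A \<and> (\<forall>B. P B \<longrightarrow> |A| \<le>o |B| )|"

lemma least_size_attained:
  assumes "P B"
  shows "\<exists>A. P A \<and> least_size P = |A|" and "least_size P \<le>o |B|"
proof -
  have "\<exists>r\<in>card_of ` Collect P. \<forall>r'\<in>card_of ` Collect P. r \<le>o r'"
    by (rule exists_minim_Card_order) (use assms card_of_Card_order in auto)
  then have "\<exists>A. P A \<and> (\<forall>B. P B \<longrightarrow> |A| \<le>o |B| )" by auto
  from someI_ex[OF this] assms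
  show "\<exists>A. P A \<and> least_size P = |A|" "least_size P \<le>o |B|"
    unfolding least_size_def by blast+
qed

definition b_num :: "nat set set \<Rightarrow> (nat \<Rightarrow> (nat \<Rightarrow> bool) set) rel" where
  "b_num J = least_size (\<lambda>F. F \<subseteq> Omega_bar \<and> \<not> (\<exists>d\<in>Omega_bar. \<forall>c\<in>F. subset_mod J c d))"

definition d_num :: "nat set set \<Rightarrow> (nat \<Rightarrow> (nat \<Rightarrow> bool) set) rel" where
  "d_num J = least_size (\<lambda>D. D \<subseteq> Omega_bar \<and> (\<forall>c\<in>Omega_bar. \<exists>d\<in>D. subset_mod J c d))"

definition finite_to_one :: "(nat \<Rightarrow> nat) \<Rightarrow> bool" where
  "finite_to_one \<phi> \<longleftrightarrow> (\<forall>n. finite (\<phi> -` {n}))"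

definition push_ideal :: "(nat \<Rightarrow> nat) \<Rightarrow> nat set set \<Rightarrow> nat set set" where
  "push_ideal \<phi> J = {A. \<phi> -` A \<in> J}"

definition KB_le :: "nat set set \<Rightarrow> nat set set \<Rightarrow> bool" where
  "KB_le K J \<longleftrightarrow> (\<exists>\<phi>. finite_to_one \<phi> \<and> K \<subseteq> push_ideal \<phi> J)"

definition RB_le :: "nat set set \<Rightarrow> nat set set \<Rightarrow> bool" where
  "RB_le K J \<longleftrightarrow> (\<exists>\<phi>. finite_to_one \<phi> \<and> K = push_ideal \<phi> J)"

definition KB_bar_le :: "nat set set \<Rightarrow> nat set set \<Rightarrow> bool" where
  "KB_bar_le K J \<longleftrightarrow> (\<exists>\<phi>. finite_to_one \<phi> \<and> push_ideal \<phi> K \<subseteq> J)"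

end

theory Submission
  imports Defs
begin

text \<open>
  For a finite-to-one \<open>\<phi>\<close>, both reindexing \<open>d \<mapsto> d \<circ> \<phi>\<close> and taking unions over the
  fibres of \<open>\<phi>\<close> can only shrink the limsup set \<open>N\<close>, so both map \<open>Omega_bar\<close> into itself.
  Since \<open>c n\<close> is contained in the union of \<open>c\<close> over the fibre of \<open>\<phi> n\<close>, the two maps form the
  Tukey connection in (a) and, with their roles exchanged, the one in (b); (c) combines both.
  A Tukey connection transports unbounded families forwards and dominating families backwards.
  The comparison of the bounding numbers also needs that unbounded families exist: if
  \<open>d \<in> Omega_bar\<close> then \<open>d n \<noteq> UNIV\<close> for all but finitely many \<open>n\<close>, and by Borel-Cantelli
  cylinders of measure \<open>(1/2)^n\<close> around points outside \<open>d n\<close> give an element of \<open>Omega_bar\<close>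
  that is not below \<open>d\<close>.
\<close>

section \<open>Cantor space as a Borel probability space\<close>

lemma prob_space_cantor_measure: "prob_space cantor_measure"
  unfolding cantor_measure_def
  by (intro prob_space_PiM prob_space_uniform_count_measure) auto

lemma space_cantor_measure [simp]: "space cantor_measure = UNIV"
  by (simp add: cantor_measure_def space_PiM space_uniform_count_measure)

text \<open>A countable base on each factor is what lets \<open>sets_PiM_equal_borel\<close>
  identify the product and Borel sigma-algebras.\<close>

instance bool :: second_countable_topology
proof
  have "open = generate_topology (UNIV :: bool set set)"
    by (auto simp: fun_eq_iff intro: generate_topology.Basis discrete_topology_class.open_discrete)
  then show "\<exists>B :: bool set set. countable B \<and> open = generate_topology B"
    by (intro exI[of _ UNIV]) (auto intro: countable_finite)
qed

lemma sets_cantor_measure: "sets cantor_measure = sets borel"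
proof -
  have "sets (uniform_count_measure (UNIV :: bool set)) = sets borel"
    by (simp add: sets_borel_eq_count_space sets_uniform_count_measure)
  then have "sets cantor_measure = sets (\<Pi>\<^sub>M i\<in>(UNIV :: nat set). (borel :: bool measure))"
    unfolding cantor_measure_def by (intro sets_PiM_cong) auto
  then show ?thesis
    by (simp add: sets_PiM_equal_borel)
qed

lemma Omega_measurable: "c \<in> Omega \<Longrightarrow> c \<in> sets cantor_measure"
  by (simp add: Omega_def sets_cantor_measure)

lemma N_set_eq_limsup: "N_set c = limsup c"
  by (auto simp: N_set_def limsup_INF_SUP infinite_nat_iff_unbounded_le)

lemma N_set_measurable:
  assumes "\<And>n. c n \<in> Omega"
  shows "N_set c \<in> sets cantor_measure"
  unfolding N_set_eq_limsup limsup_INF_SUP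
  using assms[THEN Omega_measurable] by (intro sets.countable_INT sets.countable_UN) auto

lemma Omega_bar_in_Omega: "c \<in> Omega_bar \<Longrightarrow> c n \<in> Omega"
  by (simp add: Omega_bar_def)

text \<open>The measure is not completed, so a subset of a null set must also be measurable; for
  \<open>N_set d\<close> this follows from \<open>d n\<close> being clopen.\<close>

lemma Omega_bar_mono:
  assumes "c \<in> Omega_bar" "\<And>n. d n \<in> Omega" "N_set d \<subseteq> N_set c"
  shows "d \<in> Omega_bar"
  using assms N_set_measurable[of d] null_sets_subset[of "N_set c" cantor_measure "N_set d"]
  by (auto simp: Omega_bar_def)

subsection \<open>Reindexing along a finite-to-one map\<close>

text \<open>This is the pointwise least sequence \<open>e\<close> with
  \<open>c n \<subseteq> e (\<phi> n)\<close> for all \<open>n\<close>.\<close>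

definition fiber_union ::
  "(nat \<Rightarrow> nat) \<Rightarrow> (nat \<Rightarrow> (nat \<Rightarrow> bool) set) \<Rightarrow> nat \<Rightarrow> (nat \<Rightarrow> bool) set" where
  "fiber_union \<phi> c = (\<lambda>k. \<Union>n\<in>\<phi> -` {k}. c n)"

lemma subset_fiber_union: "c n \<subseteq> fiber_union \<phi> c (\<phi> n)"
  by (auto simp: fiber_union_def)

lemma finite_vimage_finite_to_one:
  assumes "finite_to_one \<phi>" "finite A"
  shows "finite (\<phi> -` A)"
proof -
  have "\<phi> -` A = (\<Union>k\<in>A. \<phi> -` {k})" by auto
  with assms show ?thesis by (simp add: finite_to_one_def)
qed

text \<open>Finite fibres keep the unions clopen. The inclusion of limsup sets rests only on images
  of finite sets being finite.\<close>

lemma fiber_union_in_Omega_bar: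
  assumes "finite_to_one \<phi>" "c \<in> Omega_bar"
  shows "fiber_union \<phi> c \<in> Omega_bar"
proof (rule Omega_bar_mono[OF assms(2)])
  show "fiber_union \<phi> c k \<in> Omega" for k
    using assms Omega_bar_in_Omega[OF assms(2)]
    unfolding fiber_union_def Omega_def finite_to_one_def
    by (auto intro!: open_UN closed_UN)
  show "N_set (fiber_union \<phi> c) \<subseteq> N_set c"
  proof
    fix x assume "x \<in> N_set (fiber_union \<phi> c)"
    moreover have "{k. x \<in> fiber_union \<phi> c k} = \<phi> ` {n. x \<in> c n}"
      by (auto simp: fiber_union_def)
    ultimately show "x \<in> N_set c"
      by (auto simp: N_set_def)
  qed
qed

text \<open>Here clopenness is immediate, and finite fibres serve the limsup sets: the preimage of a
  finite index set is finite.\<close>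

lemma comp_in_Omega_bar:
  assumes "finite_to_one \<phi>" "d \<in> Omega_bar"
  shows "d \<circ> \<phi> \<in> Omega_bar"
proof (rule Omega_bar_mono[OF assms(2)])
  show "(d \<circ> \<phi>) n \<in> Omega" for n
    using Omega_bar_in_Omega[OF assms(2)] by simp
  show "N_set (d \<circ> \<phi>) \<subseteq> N_set d"
  proof
    fix x assume "x \<in> N_set (d \<circ> \<phi>)"
    moreover have "{n. x \<in> (d \<circ> \<phi>) n} = \<phi> -` {k. x \<in> d k}" by auto
    ultimately have "infinite (\<phi> -` {k. x \<in> d k})"
      by (simp add: N_set_def)
    then show "x \<in> N_set d"
      using finite_vimage_finite_to_one[OF assms(1)] unfolding N_set_def by blast
  qed
qed

lemma ideal_subset: "ideal_on_nat J \<Longrightarrow> A \<in> J \<Longrightarrow> B \<subseteq> A \<Longrightarrow> B \<in> J"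
  by (simp add: ideal_on_nat_def)

lemma tukey_le_if_KB_le:
  assumes J: "ideal_on_nat J" and "KB_le K J"
  shows "S_sys J \<preceq>\<^sub>T S_sys K"
proof -
  obtain \<phi> where \<phi>: "finite_to_one \<phi>" and K: "\<And>A. A \<in> K \<Longrightarrow> \<phi> -` A \<in> J"
    using assms(2) by (auto simp: KB_le_def push_ideal_def)
  have "subset_mod J c (d \<circ> \<phi>)" if "subset_mod K (fiber_union \<phi> c) d" for c d
  proof -
    \<comment> \<open>If \<open>c n\<close> is not inside \<open>d (\<phi> n)\<close>, neither is
      the larger set \<open>fiber_union \<phi> c (\<phi> n)\<close>.\<close>
    have "{n. \<not> c n \<subseteq> (d \<circ> \<phi>) n} \<subseteq> \<phi> -` {k. \<not> fiber_union \<phi> c k \<subseteq> d k}"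
      using subset_fiber_union[of c _ \<phi>] by auto
    with that K show ?thesis
      unfolding subset_mod_def by (blast intro: ideal_subset[OF J])
  qed
  with \<phi> show ?thesis
    unfolding tukey_le_def S_sys_def prod.case
    by (intro bexI[of _ "fiber_union \<phi>"] bexI[of _ "\<lambda>d. d \<circ> \<phi>"])
      (auto intro: fiber_union_in_Omega_bar comp_in_Omega_bar)
qed

lemma tukey_le_if_KB_bar_le:
  assumes K: "ideal_on_nat K" and "KB_bar_le K J"
  shows "S_sys J \<preceq>\<^sub>T S_sys K"
proof -
  obtain \<phi> where \<phi>: "finite_to_one \<phi>" and J: "\<And>A. \<phi> -` A \<in> K \<Longrightarrow> A \<in> J"
    using assms(2) by (auto simp: KB_bar_le_def push_ideal_def)
  have "subset_mod J c (fiber_union \<phi> d)" if "subset_mod K (c \<circ> \<phi>) d" for c d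
  proof -
    \<comment> \<open>Now the upper bound is enlarged: \<open>d n\<close> lies in
      \<open>fiber_union \<phi> d (\<phi> n)\<close>, so a failure at \<open>\<phi> n\<close> forces
      one at \<open>n\<close>.\<close>
    have "\<phi> -` {k. \<not> c k \<subseteq> fiber_union \<phi> d k} \<subseteq> {n. \<not> (c \<circ> \<phi>) n \<subseteq> d n}"
      using subset_fiber_union[of d _ \<phi>] by auto
    with that show ?thesis
      unfolding subset_mod_def by (blast intro: J ideal_subset[OF K])
  qed
  with \<phi> show ?thesis
    unfolding tukey_le_def S_sys_def prod.case
    by (intro bexI[of _ "\<lambda>c. c \<circ> \<phi>"] bexI[of _ "fiber_union \<phi>"])
      (auto intro: fiber_union_in_Omega_bar comp_in_Omega_bar)
qed

subsection \<open>Existence of unbounded families\<close>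

definition cylinder :: "(nat \<Rightarrow> bool) \<Rightarrow> nat \<Rightarrow> (nat \<Rightarrow> bool) set" where
  "cylinder x n = {y. \<forall>i<n. y i = x i}"

lemma cylinder_in_Omega: "cylinder x n \<in> Omega"
proof -
  have coord: "continuous_on UNIV (\<lambda>y :: nat \<Rightarrow> bool. y i)" for i
    by (rule continuous_on_product_coordinates)
  have "open {b}" "closed {b}" for b :: bool
    by (auto simp: closed_def intro: discrete_topology_class.open_discrete)
  then have "open ((\<lambda>y :: nat \<Rightarrow> bool. y i) -` {x i})"
    "closed ((\<lambda>y :: nat \<Rightarrow> bool. y i) -` {x i})" for i
    using coord by (auto intro: open_vimage closed_vimage)
  moreover have "cylinder x n = (\<Inter>i\<in>{..<n}. (\<lambda>y. y i) -` {x i})"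
    by (auto simp: cylinder_def)
  ultimately show ?thesis
    by (auto simp: Omega_def)
qed

lemma measure_cylinder: "measure cantor_measure (cylinder x n) = (1 / 2) ^ n"
proof -
  interpret product_prob_space "\<lambda>_ :: nat. uniform_count_measure (UNIV :: bool set)" UNIV
    by (intro product_prob_spaceI prob_space_uniform_count_measure) auto
  have "cylinder x n = prod_emb UNIV (\<lambda>_. uniform_count_measure UNIV) {..<n}
      (\<Pi>\<^sub>E i\<in>{..<n}. {x i})"
    by (simp add: cylinder_def prod_emb_def space_uniform_count_measure restrict_PiE_iff
        Pi_iff Ball_def set_eq_iff)
  then show ?thesis
    unfolding cantor_measure_def
    by (simp add: measure_PiM_emb sets_uniform_count_measure measure_uniform_count_measure)
qed

lemma cylinders_in_Omega_bar: "(\<lambda>n. cylinder (x n) n) \<in> Omega_bar"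
proof -
  interpret prob_space cantor_measure by (rule prob_space_cantor_measure)
  have "limsup (\<lambda>n. cylinder (x n) n) \<in> null_sets cantor_measure"
    by (rule borel_cantelli_limsup1)
      (auto simp: measure_cylinder less_top[symmetric] intro: Omega_measurable cylinder_in_Omega)
  then show ?thesis
    by (simp add: Omega_bar_def N_set_eq_limsup cylinder_in_Omega)
qed

text \<open>Otherwise every point lies in infinitely many \<open>d n\<close>, and the null set
  \<open>N_set d\<close> would be the whole space, of measure 1.\<close>

lemma finite_eq_UNIV_Omega_bar:
  assumes "d \<in> Omega_bar"
  shows "finite {n. d n = UNIV}"
proof (rule ccontr)
  assume inf: "infinite {n. d n = UNIV}"
  have "infinite {n. x \<in> d n}" for x
    by (rule infinite_super[OF _ inf]) auto
  then have "N_set d = space cantor_measure"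
    by (simp add: N_set_def)
  then show False
    using assms prob_space.emeasure_space_1[OF prob_space_cantor_measure]
    by (auto simp: Omega_bar_def null_sets_def)
qed

lemma Omega_bar_unbounded:
  assumes J: "ideal_on_nat J" and d: "d \<in> Omega_bar"
  shows "\<exists>c\<in>Omega_bar. \<not> subset_mod J c d"
proof -
  \<comment> \<open>Where \<open>d n = UNIV\<close> the point is arbitrary; this concerns only
    finitely many \<open>n\<close>, and the measure bound on cylinders holds for any
    centres.\<close>
  define x where "x n = (SOME y. y \<notin> d n)" for n
  define c where "c n = cylinder (x n) n" for n
  have "\<not> c n \<subseteq> d n" if "d n \<noteq> UNIV" for n
  proof -
    from that have "x n \<notin> d n"
      unfolding x_def by (metis UNIV_eq_I someI_ex)
    then show ?thesis
      by (auto simp: c_def cylinder_def)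
  qed
  then have "{n. \<not> c n \<subseteq> d n} \<union> {n. d n = UNIV} = UNIV"
    by auto
  then have "\<not> subset_mod J c d"
    using J finite_eq_UNIV_Omega_bar[OF d] unfolding subset_mod_def ideal_on_nat_def by metis
  then show ?thesis
    using cylinders_in_Omega_bar[of x] by (auto simp: c_def[abs_def])
qed

subsection \<open>Cardinal invariants\<close>

lemma b_num_le_if_tukey_le:
  assumes "ideal_on_nat J" and "S_sys J \<preceq>\<^sub>T S_sys K"
  shows "b_num K \<le>o b_num J"
proof -
  obtain f g where f: "f \<in> Omega_bar \<rightarrow> Omega_bar" and g: "g \<in> Omega_bar \<rightarrow> Omega_bar"
    and fg: "\<And>c d. c \<in> Omega_bar \<Longrightarrow> d \<in> Omega_bar \<Longrightarrow>
      subset_mod K (f c) d \<Longrightarrow> subset_mod J c (g d)"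
    using assms(2) unfolding tukey_le_def S_sys_def prod.case by metis
  \<comment> \<open>The whole of \<open>Omega_bar\<close> is unbounded, so the minimum defining
    \<open>b_num J\<close> is attained.\<close>
  have "Omega_bar \<subseteq> Omega_bar \<and> \<not> (\<exists>d\<in>Omega_bar. \<forall>c\<in>Omega_bar. subset_mod J c d)"
    using Omega_bar_unbounded[OF assms(1)] by blast
  from least_size_attained(1)[where P = "\<lambda>F. F \<subseteq> Omega_bar \<and> \<not> (\<exists>d\<in>Omega_bar. \<forall>c\<in>F. subset_mod J c d)",
      OF this, folded b_num_def]
  obtain F where F: "F \<subseteq> Omega_bar" "\<not> (\<exists>d\<in>Omega_bar. \<forall>c\<in>F. subset_mod J c d)" "b_num J = |F|"
    by blast
  have "\<not> (\<exists>d\<in>Omega_bar. \<forall>c\<in>f ` F. subset_mod K c d)"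
  proof
    assume "\<exists>d\<in>Omega_bar. \<forall>c\<in>f ` F. subset_mod K c d"
    then obtain d where "d \<in> Omega_bar" "\<And>c. c \<in> F \<Longrightarrow> subset_mod K (f c) d"
      by blast
    with F(1) fg have "\<forall>c\<in>F. subset_mod J c (g d)"
      by blast
    with F(2) funcset_mem[OF g \<open>d \<in> Omega_bar\<close>] show False
      by blast
  qed
  with F(1) f have "f ` F \<subseteq> Omega_bar \<and> \<not> (\<exists>d\<in>Omega_bar. \<forall>c\<in>f ` F. subset_mod K c d)"
    by auto
  then have "b_num K \<le>o |f ` F|"
    unfolding b_num_def by (rule least_size_attained(2))
  also have "|f ` F| \<le>o |F|"
    by (rule card_of_image)
  finally show ?thesis
    using F(3) by simp
qed

lemma d_num_le_if_tukey_le: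
  assumes "ideal_on_nat K" and "S_sys J \<preceq>\<^sub>T S_sys K"
  shows "d_num J \<le>o d_num K"
proof -
  obtain f g where f: "f \<in> Omega_bar \<rightarrow> Omega_bar" and g: "g \<in> Omega_bar \<rightarrow> Omega_bar"
    and fg: "\<And>c d. c \<in> Omega_bar \<Longrightarrow> d \<in> Omega_bar \<Longrightarrow>
      subset_mod K (f c) d \<Longrightarrow> subset_mod J c (g d)"
    using assms(2) unfolding tukey_le_def S_sys_def prod.case by metis
  \<comment> \<open>By reflexivity \<open>Omega_bar\<close> dominates itself, so
    \<open>d_num K\<close> is attained.\<close>
  have "subset_mod K c c" for c
    using assms(1) by (simp add: subset_mod_def ideal_on_nat_def)
  then have "Omega_bar \<subseteq> Omega_bar \<and> (\<forall>c\<in>Omega_bar. \<exists>d\<in>Omega_bar. subset_mod K c d)"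
    by blast
  from least_size_attained(1)[where P = "\<lambda>D. D \<subseteq> Omega_bar \<and> (\<forall>c\<in>Omega_bar. \<exists>d\<in>D. subset_mod K c d)",
      OF this, folded d_num_def]
  obtain D where D: "D \<subseteq> Omega_bar" "\<And>c. c \<in> Omega_bar \<Longrightarrow> \<exists>d\<in>D. subset_mod K c d" "d_num K = |D|"
    by blast
  have "\<exists>d\<in>g ` D. subset_mod J c d" if "c \<in> Omega_bar" for c
    using D(1) D(2)[OF funcset_mem[OF f that]] fg[OF that] by blast
  then have "g ` D \<subseteq> Omega_bar \<and> (\<forall>c\<in>Omega_bar. \<exists>d\<in>g ` D. subset_mod J c d)"
    using D(1) g by auto
  then have "d_num J \<le>o |g ` D|"
    unfolding d_num_def by (rule least_size_attained(2))
  also have "|g ` D| \<le>o |D|"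
    by (rule card_of_image)
  finally show ?thesis
    using D(3) by simp
qed

theorem theorem5p11:
  fixes J K :: "nat set set"
  assumes "ideal_on_nat J" and "ideal_on_nat K"
  shows "(KB_le K J \<longrightarrow>
            S_sys J \<preceq>\<^sub>T S_sys K \<and> b_num K \<le>o b_num J \<and> d_num J \<le>o d_num K) \<and>
         (KB_bar_le K J \<longrightarrow>
            S_sys J \<preceq>\<^sub>T S_sys K \<and> b_num K \<le>o b_num J \<and> d_num J \<le>o d_num K) \<and>
         (RB_le K J \<longrightarrow>
            S_sys K \<preceq>\<^sub>T S_sys J \<and> S_sys J \<preceq>\<^sub>T S_sys K \<and>
            b_num K =o b_num J \<and> d_num K =o d_num J)"
proof -
  \<comment> \<open>The two inclusions in \<open>K = push_ideal \<phi> J\<close> give one relation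
    each; the second has \<open>J\<close> and \<open>K\<close> exchanged and so yields the converse
    Tukey connection.\<close>
  have "KB_le K J \<and> KB_bar_le J K" if "RB_le K J"
    using that by (auto simp: RB_le_def KB_le_def KB_bar_le_def)
  then show ?thesis
    using assms
    by (simp add: tukey_le_if_KB_le tukey_le_if_KB_bar_le b_num_le_if_tukey_le
        d_num_le_if_tukey_le ordIso_iff_ordLeq)
qed

end
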